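(* Let $m,n$ be positive integers and let $\zeta$ be a real transcendental number. Then $$\widehat{\lambda}_{m+n-1}(\zeta)\leq \max\left\{\frac{1}{w_{m}(\zeta)},\frac{1}{\widehat{w}_{n}(\zeta)}\right\}.$$
   Context: For an integer $k\geq 1$ and a real transcendental number $\zeta$: $\widehat{\lambda}_{k}(\zeta)$ is the supremum of $\eta\in\mathbb{R}$ such that for all sufficiently large $X$ the system $|x|\leq X$, $\max_{1\leq i\leq k}|\zeta^{i}x-y_{i}|\leq X^{-\eta}$ has a non-zero solution $(x,y_{1},\ldots,y_{k})\in\mathbb{Z}^{k+1}$. For a polynomial $P$ with integer coefficients, the height $H(P)$ is the maximum of the absolute values of its coefficients. $w_{k}(\zeta)$ (respectively $\widehat{w}_{k}(\zeta)$) is the supremum of $\eta\in\mathbb{R}$ such that the system $H(P)\leq X$, $0<|P(\zeta)|\leq X^{-\eta}$ has a solution $P\in\mathbb{Z}[T]$ of degree at most $k$ for arbitrarily large $X$ (respectively for all sufficiently large $X$). Exponents may take the value $\infty$, and $1/\infty=0$. *)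

theory Defs
  imports
    Complex_Main
    "HOL-Library.Extended_Real"
    "HOL-Computational_Algebra.Polynomial"
begin

(* All exponents take values in ereal, where 1 / \<infinity> = 0. The suprema range over
   real \<eta>, and the parameter X is real. *)

(* The parameter k is meant to be at least 1, so that the maximum is over a non-empty set.
   Only the values y 1, ..., y k of the function y are relevant. *)
definition simul_approx_exp_unif :: "nat \<Rightarrow> real \<Rightarrow> ereal" where
  "simul_approx_exp_unif k \<zeta> =
     (SUP \<eta> \<in> {\<eta> :: real. \<forall>\<^sub>F X :: real in at_top. \<exists>(x :: int) (y :: nat \<Rightarrow> int).
          (x \<noteq> 0 \<or> (\<exists>i\<in>{1..k}. y i \<noteq> 0)) \<and>
          \<bar>real_of_int x\<bar> \<le> X \<and>
          (MAX i\<in>{1..k}. \<bar>\<zeta> ^ i * real_of_int x - real_of_int (y i)\<bar>) \<le> X powr (-\<eta>)}.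
        ereal \<eta>)"

definition poly_height :: "int poly \<Rightarrow> int" where
  "poly_height P = (MAX i\<in>{..degree P}. \<bar>coeff P i\<bar>)"

definition small_poly_value :: "nat \<Rightarrow> real \<Rightarrow> real \<Rightarrow> real \<Rightarrow> bool" where
  "small_poly_value k \<zeta> \<eta> X \<longleftrightarrow>
     (\<exists>P :: int poly. degree P \<le> k \<and> real_of_int (poly_height P) \<le> X \<and>
        0 < \<bar>poly (map_poly of_int P) \<zeta>\<bar> \<and>
        \<bar>poly (map_poly of_int P) \<zeta>\<bar> \<le> X powr (-\<eta>))"

definition poly_approx_exp :: "nat \<Rightarrow> real \<Rightarrow> ereal" where
  "poly_approx_exp k \<zeta> =
     (SUP \<eta> \<in> {\<eta> :: real. \<exists>\<^sub>F X in at_top. small_poly_value k \<zeta> \<eta> X}. ereal \<eta>)"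

definition poly_approx_exp_unif :: "nat \<Rightarrow> real \<Rightarrow> ereal" where
  "poly_approx_exp_unif k \<zeta> =
     (SUP \<eta> \<in> {\<eta> :: real. \<forall>\<^sub>F X in at_top. small_poly_value k \<zeta> \<eta> X}. ereal \<eta>)"

end

theory Submission
  imports Defs "Berlekamp_Zassenhaus.Factor_Bound" "HOL-Real_Asymp.Real_Asymp"
begin

text \<open>
  Suppose that \<open>\<eta>\<close> is admissible for the simultaneous exponent and exceeds both \<open>1 / w\<^sub>m\<close> and
  \<open>1 / w'\<^sub>n\<close>, where \<open>w'\<^sub>n\<close> is the uniform polynomial exponent, and let \<open>k = m + n - 1\<close>. Choose
  \<open>u < v\<close> below both polynomial exponents with \<open>u \<eta> > 1\<close>.

  For an integer vector \<open>(x, y\<^sub>1, \<dots>, y\<^sub>k)\<close> with all \<open>y\<^sub>j\<close> close to \<open>\<zeta>\<^sup>j x\<close>, consider the linear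
  functional \<open>L\<close> on polynomials of degree at most \<open>k\<close> that maps \<open>X\<^sup>j\<close> to \<open>y\<^sub>j\<close> and 1 to \<open>x\<close>. On an
  integer polynomial \<open>R\<close> its value is an integer, and it differs from \<open>x R(\<zeta>)\<close> by at most
  \<open>k + 1\<close> times the height of \<open>R\<close> times the approximation error. Hence \<open>L(R) = 0\<close> as soon as
  both \<open>x R(\<zeta>)\<close> and this error are small (\<open>coeff_pairing_shift_eq_0\<close>).

  The definition of \<open>w\<^sub>m\<close> gives polynomials \<open>P\<close> of degree at most \<open>m\<close>, of large height \<open>H\<close>, with
  \<open>\<bar>P(\<zeta>)\<bar> \<le> H powr -v\<close>, and by Gelfond's inequality on heights of products \<open>P\<close> can be
  taken irreducible (\<open>irreducible_approximants\<close>). Now apply the uniform exponent at the parameter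
  \<open>c H\<close> with a small constant \<open>c\<close>: this gives \<open>Q\<close> of degree at most \<open>n\<close> and height at most
  \<open>c H\<close> with \<open>\<bar>Q(\<zeta>)\<bar> \<le> (c H) powr -v\<close>. Again by Gelfond's inequality, the height of \<open>Q\<close> is too small for a
  multiple of \<open>P\<close>, so \<open>P\<close> and \<open>Q\<close> are coprime.

  Take the non-zero vector that solves the simultaneous system at the parameter \<open>H powr u\<close>. The
  condition \<open>u < v\<close> makes \<open>x P(\<zeta>)\<close> and \<open>x Q(\<zeta>)\<close> small, and \<open>u \<eta> > 1\<close> makes the errors small, so
  \<open>L\<close> vanishes on all \<open>X\<^sup>i P\<close> and \<open>X\<^sup>i Q\<close> of degree at most \<open>k\<close>. Since \<open>degree P + degree Q \<le> k + 1\<close>,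
  these polynomials span the whole space (\<open>coprime_multiples_annihilate\<close>). Therefore \<open>L = 0\<close>, and the
  vector is zero, a contradiction.
\<close>

hide_const (open) up_ring.coeff up_ring.monom module.smult comm_monoid_mult_class.coprime

section \<open>Heights of integer polynomials\<close>

lemma abs_coeff_le_poly_height: "\<bar>coeff P i\<bar> \<le> poly_height P"
proof (cases "i \<le> degree P")
  case True
  then show ?thesis unfolding poly_height_def by (intro Max_ge) auto
next
  case False
  have "\<bar>coeff P 0\<bar> \<le> poly_height P"
    unfolding poly_height_def by (intro Max_ge) auto
  with False show ?thesis by (simp add: coeff_eq_0)
qed

lemma poly_height_attained: "\<exists>i\<le>degree P. poly_height P = \<bar>coeff P i\<bar>"
proof -
  have "poly_height P \<in> (\<lambda>i. \<bar>coeff P i\<bar>) ` {..degree P}"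
    unfolding poly_height_def by (intro Max_in) auto
  then show ?thesis by auto
qed

lemma poly_height_ge_1:
  assumes "P \<noteq> 0"
  shows "poly_height P \<ge> 1"
  using abs_coeff_le_poly_height[of P "degree P"] assms
  by (smt (verit) leading_coeff_0_iff)

lemma finite_bounded_height: "finite {P. degree P \<le> d \<and> poly_height P \<le> B}"
proof (rule finite_subset)
  show "finite (Poly ` {xs. set xs \<subseteq> {-B..B} \<and> length xs \<le> Suc d})"
    by (intro finite_imageI finite_lists_length_le) simp
  show "{P. degree P \<le> d \<and> poly_height P \<le> B}
          \<subseteq> Poly ` {xs. set xs \<subseteq> {-B..B} \<and> length xs \<le> Suc d}"
  proof
    fix P assume P: "P \<in> {P. degree P \<le> d \<and> poly_height P \<le> B}"
    have "set (coeffs P) \<subseteq> {-B..B}"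
    proof
      fix c assume "c \<in> set (coeffs P)"
      then obtain i where "c = coeff P i"
        by (metis in_set_conv_nth coeffs_nth length_coeffs_degree less_Suc_eq_le list.size(3) 
              coeffs_0_eq_Nil not_less_zero)
      then show "c \<in> {-B..B}"
        using P abs_coeff_le_poly_height[of P i] by auto
    qed
    moreover have "length (coeffs P) \<le> Suc d"
      using P by (cases "P = 0") (auto simp: length_coeffs_degree)
    ultimately show "P \<in> Poly ` {xs. set xs \<subseteq> {-B..B} \<and> length xs \<le> Suc d}"
      by (intro image_eqI[of _ _ "coeffs P"]) auto
  qed
qed

lemma poly_height_le_mahler_measure:
  "real_of_int (poly_height f) \<le> 2 ^ degree f * mahler_measure f"
proof -
  obtain i where i: "i \<le> degree f" "poly_height f = \<bar>coeff f i\<bar>"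
    using poly_height_attained by blast
  have "real_of_int (poly_height f) \<le> (degree f choose i) * mahler_measure f"
    using Mignotte_bound[of f i] i by simp
  also have "\<dots> \<le> 2 ^ degree f * mahler_measure f"
  proof (rule mult_right_mono)
    have "real (degree f choose i) \<le> real (2 ^ degree f)"
      by (rule of_nat_mono[OF binomial_le_pow2])
    then show "real (degree f choose i) \<le> 2 ^ degree f" by simp
  qed (rule mahler_measure_ge_0)
  finally show ?thesis .
qed

lemma mahler_measure_le_poly_height:
  "mahler_measure f \<le> real (Suc (degree f)) * real_of_int (poly_height f)"
proof -
  let ?H = "real_of_int (poly_height f)" and ?N = "real (Suc (degree f))"
  have H: "0 \<le> ?H" using abs_coeff_le_poly_height[of f 0] by linarith
  have "sum_list (map (\<lambda>a. (cmod a)\<^sup>2) (coeffs (of_int_poly f))) \<le> ?N * ?H\<^sup>2"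
  proof -
    have "(cmod a)\<^sup>2 \<le> ?H\<^sup>2" if "a \<in> set (coeffs (of_int_poly f))" for a
    proof -
      from that obtain i where "a = of_int (coeff f i)"
        by (auto simp: coeffs_def split: if_splits)
      then have "cmod a \<le> ?H"
        using abs_coeff_le_poly_height[of f i] by simp
      then show ?thesis by (intro power_mono) auto
    qed
    then have "sum_list (map (\<lambda>a. (cmod a)\<^sup>2) (coeffs (of_int_poly f)))
                 \<le> sum_list (map (\<lambda>a. ?H\<^sup>2) (coeffs (of_int_poly f :: complex poly)))"
      by (intro sum_list_mono) auto
    also have "\<dots> = real (length (coeffs f)) * ?H\<^sup>2"
      by (simp add: map_replicate_const sum_list_replicate)
    also have "\<dots> \<le> ?N * ?H\<^sup>2"
      by (intro mult_right_mono) (cases "f = 0", auto simp: length_coeffs_degree)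
    finally show ?thesis .
  qed
  also have "\<dots> \<le> (?N * ?H)\<^sup>2"
    unfolding power_mult_distrib by (intro mult_right_mono) (auto simp: power2_eq_square)
  finally have "sqrt (sum_list (map (\<lambda>a. (cmod a)\<^sup>2) (coeffs (of_int_poly f)))) \<le> ?N * ?H"
    using H by (intro real_le_lsqrt) auto
  then show ?thesis
    using Landau_inequality[of "of_int_poly f"] unfolding mahler_measure_def by simp
qed

text \<open>Gelfond's inequality: up to a factor depending only on the degree, the height is
  supermultiplicative. The height is comparable with the Mahler measure (coefficients are
  elementary symmetric functions of the roots in one direction, Landau's inequality in the
  other), and the Mahler measure is multiplicative.\<close>

lemma poly_height_mult_le:
  assumes "f * g \<noteq> 0" and "degree (f * g) \<le> D"
  shows "real_of_int (poly_height f) * real_of_int (poly_height g)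
           \<le> (4 ^ D * real (Suc D)) * real_of_int (poly_height (f * g))"
proof -
  have deg: "degree f + degree g = degree (f * g)"
    using assms by (simp add: degree_mult_eq)
  have ge1: "poly_height f \<ge> 1" "poly_height g \<ge> 1" "poly_height (f * g) \<ge> 1"
    using assms poly_height_ge_1 by auto
  have "real_of_int (poly_height f) * real_of_int (poly_height g)
          \<le> (2 ^ degree f * mahler_measure f) * (2 ^ degree g * mahler_measure g)"
    using ge1 by (intro mult_mono poly_height_le_mahler_measure) (auto simp: mahler_measure_ge_0)
  also have "\<dots> = 2 ^ degree (f * g) * mahler_measure (f * g)"
    unfolding mahler_measure_def deg[symmetric]
    by (simp add: measure_eq_prod power_add of_int_poly_hom.hom_mult)
  also have "\<dots> \<le> 2 ^ degree (f * g) * (real (Suc (degree (f * g))) * real_of_int (poly_height (f * g)))"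
    by (intro mult_left_mono mahler_measure_le_poly_height) auto
  also have "\<dots> \<le> 4 ^ D * (real (Suc D) * real_of_int (poly_height (f * g)))"
  proof (intro mult_mono)
    have "(2::real) ^ degree (f * g) \<le> 2 ^ D" using assms by (intro power_increasing) auto
    also have "\<dots> \<le> 4 ^ D" by (intro power_mono) auto
    finally show "(2::real) ^ degree (f * g) \<le> 4 ^ D" .
  qed (use assms ge1 in auto)
  finally show ?thesis by (simp add: mult.assoc)
qed

text \<open>A non-zero cofactor has height at least 1, so Gelfond's inequality
  bounds the height of a divisor. This is what later rules out that an approximating polynomial
  of small height is a multiple of one of large height.\<close>

lemma poly_height_le_if_dvd:
  assumes "P dvd Q" and "Q \<noteq> 0" and "degree Q \<le> D"
  shows "real_of_int (poly_height P) \<le> (4 ^ D * real (Suc D)) * real_of_int (poly_height Q)"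
proof -
  obtain S where S: "Q = P * S" using assms(1) by (elim dvdE)
  then have nz: "P \<noteq> 0" "S \<noteq> 0" using assms by auto
  have "real_of_int (poly_height P) * 1 \<le> real_of_int (poly_height P) * real_of_int (poly_height S)"
    using poly_height_ge_1[OF nz(1)] poly_height_ge_1[OF nz(2)] by (intro mult_left_mono) auto
  also have "\<dots> \<le> (4 ^ D * real (Suc D)) * real_of_int (poly_height Q)"
    using poly_height_mult_le[of P S D] assms S by simp
  finally show ?thesis by simp
qed

lemma poly_transcendental_nonzero:
  assumes "\<not> algebraic \<zeta>" and "P \<noteq> 0"
  shows "poly (of_int_poly P) (\<zeta>::real) \<noteq> 0"
proof
  assume "poly (of_int_poly P) \<zeta> = 0"
  then have "algebraic \<zeta>"
    using assms(2) by (intro algebraicI[of "of_int_poly P"]) auto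
  with assms(1) show False ..
qed

section \<open>Linear functionals vanishing on the multiples of two coprime polynomials\<close>

text \<open>The linear functional on polynomials that maps \<open>X\<^sup>j\<close> to \<open>z j\<close> for
  \<open>j \<le> k\<close>, and to zero for larger \<open>j\<close>.\<close>

definition coeff_pairing :: "nat \<Rightarrow> (nat \<Rightarrow> 'a) \<Rightarrow> 'a poly \<Rightarrow> 'a::comm_ring_1" where
  "coeff_pairing k z R = (\<Sum>j\<le>k. coeff R j * z j)"

lemma coeff_pairing_add: "coeff_pairing k z (R + S) = coeff_pairing k z R + coeff_pairing k z S"
  by (simp add: coeff_pairing_def distrib_right sum.distrib)

lemma coeff_pairing_smult: "coeff_pairing k z (smult c R) = c * coeff_pairing k z R"
  by (simp add: coeff_pairing_def sum_distrib_left mult.assoc)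

lemma coeff_pairing_sum: "coeff_pairing k z (\<Sum>i\<in>I. f i) = (\<Sum>i\<in>I. coeff_pairing k z (f i))"
  by (simp add: coeff_pairing_def coeff_sum sum_distrib_right sum.swap[of _ "{..k}" I])

lemma coeff_pairing_monom:
  assumes "j \<le> k"
  shows "coeff_pairing k z (monom 1 j) = z j"
proof -
  have "coeff_pairing k z (monom 1 j) = (\<Sum>i\<le>k. if i = j then z i else 0)"
    unfolding coeff_pairing_def by (intro sum.cong) auto
  also have "\<dots> = z j" using assms by simp
  finally show ?thesis .
qed

lemma coeff_pairing_of_int:
  "coeff_pairing k (\<lambda>j. of_int (z j)) (of_int_poly R) = of_int (coeff_pairing k z R)"
  by (simp add: coeff_pairing_def)

lemma coeff_pairing_mult_eq_0:
  assumes "\<And>i. i + degree P \<le> k \<Longrightarrow> coeff_pairing k z (monom 1 i * P) = 0"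
    and "A = 0 \<or> degree A + degree P \<le> k"
  shows "coeff_pairing k z (A * P) = 0"
proof (cases "A = 0")
  case True
  then show ?thesis by (simp add: coeff_pairing_def)
next
  case False
  have "A * P = (\<Sum>i\<le>degree A. smult (coeff A i) (monom 1 i * P))"
  proof -
    have "A = (\<Sum>i\<le>degree A. smult (coeff A i) (monom 1 i))"
      using poly_as_sum_of_monoms[of A] by (simp add: smult_monom)
    then have "A * P = (\<Sum>i\<le>degree A. smult (coeff A i) (monom 1 i)) * P" by simp
    then show ?thesis by (simp add: sum_distrib_right)
  qed
  then have "coeff_pairing k z (A * P) 
    = (\<Sum>i\<le>degree A. coeff A i * coeff_pairing k z (monom 1 i * P))"
    by (simp only: coeff_pairing_sum coeff_pairing_smult)
  also have "\<dots> = 0"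
    using assms False by (intro sum.neutral) auto
  finally show ?thesis .
qed

text \<open>Coprime \<open>P\<close> and \<open>Q\<close> with \<open>degree P + degree Q \<le> k + 1\<close> have multiples that
  together span all polynomials of degree at most \<open>k\<close>, so a functional killing these multiples
  is zero. This is the non-vanishing of the resultant in disguise. Bezout's identity writes a given
  \<open>R\<close> as a combination of \<open>P\<close> and \<open>Q\<close>; reducing the cofactor of \<open>Q\<close> modulo \<open>P\<close> keeps every term
  within degree \<open>k\<close>.\<close>

lemma coprime_multiples_annihilate:
  fixes P Q :: "'a :: field_gcd poly"
  assumes "coprime P Q" and "degree P > 0" and "degree P + degree Q \<le> Suc k"
    and P: "\<And>i. i + degree P \<le> k \<Longrightarrow> coeff_pairing k z (monom 1 i * P) = 0"
    and Q: "\<And>i. i + degree Q \<le> k \<Longrightarrow> coeff_pairing k z (monom 1 i * Q) = 0"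
    and "j \<le> k"
  shows "z j = 0"
proof -
  obtain A B where AB: "A * P + B * Q = 1"
    using bezout_coefficients_fst_snd[of P Q] \<open>coprime P Q\<close> by auto
  define R where "R = (monom 1 j :: 'a poly)"
  define B' where "B' = (R * B) mod P"
  define D where "D = (R * B) div P"
  define A' where "A' = R * A + D * Q"
  have P0: "P \<noteq> 0" using assms by auto
  have R: "R = A' * P + B' * Q"
  proof -
    have D: "R * B = D * P + B'"
      unfolding B'_def D_def by (rule div_mult_mod_eq[symmetric])
    have "A' * P + B' * Q = R * (A * P) + (D * P + B') * Q"
      unfolding A'_def by (simp add: algebra_simps)
    also have "\<dots> = R * (A * P + B * Q)" unfolding D[symmetric] by (simp add: algebra_simps)
    finally show ?thesis by (simp add: AB)
  qed
  have degB: "degree B' < degree P"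
    unfolding B'_def using degree_mod_less_degree[OF P0, of "R * B"] assms
    by (metis degree_mod_less' bot_nat_0.not_eq_extremum degree_0)
  then have BQ: "degree B' + degree Q \<le> k"
    using assms by linarith
  have "degree A' + degree P \<le> k" if "A' \<noteq> 0"
  proof -
    have "degree A' + degree P = degree (A' * P)"
      using that P0 by (simp add: degree_mult_eq)
    also have "A' * P = R - B' * Q" by (simp add: R)
    also have "degree \<dots> \<le> k"
    proof (rule degree_diff_le)
      show "degree R \<le> k" using \<open>j \<le> k\<close> degree_monom_le[of "1::'a" j] by (simp add: R_def)
      show "degree (B' * Q) \<le> k" using degree_mult_le[of B' Q] BQ by linarith
    qed
    finally show ?thesis .
  qed
  then have "coeff_pairing k z (A' * P) = 0"
    by (intro coeff_pairing_mult_eq_0[OF P]) auto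
  moreover have "coeff_pairing k z (B' * Q) = 0"
    using BQ by (intro coeff_pairing_mult_eq_0[OF Q]) auto
  ultimately have "coeff_pairing k z R = 0"
    by (simp add: R coeff_pairing_add)
  then show ?thesis
    using \<open>j \<le> k\<close> by (simp add: R_def coeff_pairing_monom)
qed

text \<open>Gauss's lemma: clear the denominators of the rational quotient and cancel
  the integer factor against the primitive \<open>P\<close>.\<close>

lemma primitive_dvd_if_rat_dvd:
  assumes "content P = 1" and "map_poly rat_of_int P dvd map_poly rat_of_int Q"
  shows "P dvd Q"
proof -
  obtain S where S: "map_poly rat_of_int Q = map_poly rat_of_int P * S"
    using assms(2) by (elim dvdE)
  obtain d T where "rat_to_int_poly S = (d, T)" by force
  from rat_to_int_poly[OF this]
  have T: "smult (of_int d) S = map_poly rat_of_int T" and "d > 0" by auto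
  have "map_poly rat_of_int (smult d Q) = map_poly rat_of_int (P * T)"
    by (simp add: of_int_hom.map_poly_hom_smult S of_int_poly_hom.hom_mult flip: T)
  then have "smult d Q = P * T" by simp
  then have "primitive_part P dvd Q"
    using \<open>d > 0\<close> by (intro dvd_smult_int[of d]) auto
  moreover have "primitive_part P = P"
    using assms(1) by (rule primitive_part_prim)
  ultimately show ?thesis by simp
qed

lemma irreducible_imp_coprime_rat:
  assumes "irreducible P" and "degree P > 0" and "\<not> P dvd Q"
  shows "coprime (map_poly rat_of_int P) (map_poly rat_of_int Q)"
proof -
  have prim: "content P = 1"
    using assms nonconst_poly_irreducible_iff[of P] by simp
  with assms have "irreducible\<^sub>d P"
    by (simp add: irreducible\<^sub>d_as_irreducible primitive_part_prim)
  then have "irreducible (map_poly rat_of_int P)"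
    using irreducible\<^sub>d_int_rat by simp
  then show ?thesis
    using primitive_dvd_if_rat_dvd[OF prim] assms(3)
    by (intro prime_elem_imp_coprime field_poly_irreducible_imp_prime) auto
qed

text \<open>Integer version: the functional with integer values is extended to
  rational polynomials, where irreducibility and non-divisibility give coprimality.\<close>

lemma irreducible_not_dvd_annihilate:
  fixes P Q :: "int poly"
  assumes "irreducible P" and "degree P > 0" and "\<not> P dvd Q" 
    and "degree P + degree Q \<le> Suc k"
    and P: "\<And>i. i + degree P \<le> k \<Longrightarrow> coeff_pairing k z (monom 1 i * P) = 0"
    and Q: "\<And>i. i + degree Q \<le> k \<Longrightarrow> coeff_pairing k z (monom 1 i * Q) = 0"
    and "j \<le> k"
  shows "z j = 0"
proof -
  have transfer: "coeff_pairing k (\<lambda>j. rat_of_int (z j)) (monom 1 i * of_int_poly R)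
      = of_int (coeff_pairing k z (monom 1 i * R))" for i R
    by (simp add: of_int_poly_hom.hom_mult flip: coeff_pairing_of_int)
  have "rat_of_int (z j) = 0"
    by (rule coprime_multiples_annihilate[OF irreducible_imp_coprime_rat, of P Q k "\<lambda>j. rat_of_int (z j)" j])
      (use assms in \<open>auto simp: transfer\<close>)
  then show ?thesis by simp
qed

section \<open>Irreducible approximating polynomials\<close>

text \<open>A lower bound \<open>\<bar>P(\<zeta>)\<bar> > H(P) powr -v\<close> for the irreducible polynomials of large
  height yields, with a constant, one for all non-zero polynomials. By induction on the
  degree: a polynomial that splits into factors of smaller degree inherits the bound from them,
  since heights are multiplicative up to constants. Dividing out the content increases neither the
  height nor the value at \<open>\<zeta>\<close>. The irreducible polynomials of small height are finitely many, and
  none vanishes at the transcendental \<open>\<zeta>\<close>.\<close>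

lemma poly_lower_bound_of_irreducible:
  fixes \<zeta> v B :: real
  assumes \<zeta>: "\<not> algebraic \<zeta>" and v: "v \<ge> 0"
    and irr: "\<And>P. \<lbrakk>irreducible P; degree P > 0; degree P \<le> d; real_of_int (poly_height P) \<ge> B\<rbrakk>
                \<Longrightarrow> \<bar>poly (of_int_poly P) \<zeta>\<bar> > real_of_int (poly_height P) powr (-v)"
  shows "\<exists>C>0. \<forall>P. P \<noteq> 0 \<longrightarrow> degree P \<le> d \<longrightarrow>
           \<bar>poly (of_int_poly P) \<zeta>\<bar> \<ge> C * real_of_int (poly_height P) powr (-v)"
  using irr
proof (induction d)
  case 0
  have "\<bar>poly (of_int_poly P) \<zeta>\<bar> \<ge> 1 * real_of_int (poly_height P) powr (-v)"
    if P: "P \<noteq> 0" "degree P \<le> 0" for P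
  proof -
    from P obtain c where c: "P = [:c:]" "c \<noteq> 0"
      by (metis degree_eq_zeroE le_zero_eq pCons_eq_0_iff)
    have "real_of_int (poly_height P) powr (-v) \<le> 1 powr (-v)"
      using v poly_height_ge_1[OF P(1)] by (intro powr_mono2') auto
    also have "\<dots> \<le> \<bar>poly (of_int_poly P) \<zeta>\<bar>"
      using c by simp
    finally show ?thesis by simp
  qed
  then show ?case by (intro exI[of _ 1]) auto
next
  case (Suc d)
  define val where "val = (\<lambda>P. \<bar>poly (of_int_poly P) \<zeta>\<bar>)"
  define H where "H = (\<lambda>P. real_of_int (poly_height P))"
  have H1: "H P \<ge> 1" if "P \<noteq> 0" for P
    using poly_height_ge_1[OF that] by (simp add: H_def)
  have val_mult: "val (P * R) = val P * val R" for P R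
    by (simp add: val_def of_int_poly_hom.hom_mult abs_mult)
  obtain C where C: "C > 0" "\<And>P. P \<noteq> 0 \<Longrightarrow> degree P \<le> d \<Longrightarrow> val P \<ge> C * H P powr (-v)"
    using Suc.IH[OF Suc.prems] unfolding val_def H_def by auto
  define K where "K = 4 ^ Suc d * real (Suc (Suc d))"
  have K: "K > 0" by (simp add: K_def)
  define F where "F = {P :: int poly. degree P \<le> Suc d \<and> poly_height P \<le> \<lceil>B\<rceil>} - {0}"
  have finF: "finite F"
    unfolding F_def using finite_bounded_height by blast
  \<comment> \<open>The least value at \<open>\<zeta>\<close> over the finitely many polynomials of small height;
    the extra 1 makes the set non-empty and gives \<open>E \<le> 1\<close>.\<close>
  define E where "E = Min (insert 1 (val ` F))"
  have E: "E > 0"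
    unfolding E_def using finF poly_transcendental_nonzero[OF \<zeta>]
    by (subst Min_gr_iff) (auto simp: val_def F_def)
  have E_le: "E \<le> 1" "\<And>P. P \<in> F \<Longrightarrow> E \<le> val P"
    unfolding E_def using finF by auto
  define C' where "C' = min E (C * C * K powr (-v))"
  have C': "C' > 0" using E C K by (simp add: C'_def)
  have primitive_bound: "val P \<ge> C' * H P powr (-v)" 
    if P: "P \<noteq> 0" "degree P \<le> Suc d" "content P = 1" "degree P > 0" for P
  proof (cases "irreducible P")
    case True
    have le1: "H P powr (-v) \<le> 1"
      using powr_mono2'[of "-v" 1 "H P"] v H1[OF P(1)] by simp
    show ?thesis
    proof (cases "H P \<ge> B")
      case big: True
      then have "val P \<ge> 1 * H P powr (-v)"
        using Suc.prems[of P] True P by (simp add: val_def H_def)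
      moreover have "C' * H P powr (-v) \<le> 1 * H P powr (-v)"
        using E_le by (intro mult_right_mono) (auto simp: C'_def)
      ultimately show ?thesis by linarith
    next
      case small: False
      then have "P \<in> F" using P by (auto simp: F_def H_def) linarith
      moreover have "C' * H P powr (-v) \<le> E * 1"
        using le1 E by (intro mult_mono) (auto simp: C'_def)
      ultimately show ?thesis using E_le(2)[of P] by linarith
    qed
  next
    case False
    then have "\<not> irreducible\<^sub>d P"
      using P by (simp add: irreducible\<^sub>d_as_irreducible primitive_part_prim)
    then obtain f g where fg: "degree f < degree P" "degree g < degree P" "P = f * g"
      using P by (auto simp: irreducible\<^sub>d_def)
    then have nz: "f \<noteq> 0" "g \<noteq> 0" using P by auto
    have "H f * H g \<le> K * H P"
      using poly_height_mult_le[of f g "Suc d"] P fg by (simp add: H_def K_def)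
    then have "(C * C) * (K * H P) powr (-v) \<le> (C * C) * (H f * H g) powr (-v)"
      using v C H1[OF nz(1)] H1[OF nz(2)] by (intro mult_left_mono powr_mono2') auto
    also have "\<dots> = (C * H f powr (-v)) * (C * H g powr (-v))"
      using H1[OF nz(1)] H1[OF nz(2)] by (simp add: powr_mult)
    also have "\<dots> \<le> val f * val g"
      using nz fg P C by (intro mult_mono C(2)) (auto simp: val_def)
    also have "\<dots> = val P" by (simp add: fg(3) val_mult)
    finally have "(C * C * K powr (-v)) * H P powr (-v) \<le> val P"
      using K H1[OF P(1)] by (simp add: powr_mult mult_ac)
    moreover have "C' * H P powr (-v) \<le> (C * C * K powr (-v)) * H P powr (-v)"
      by (intro mult_right_mono) (auto simp: C'_def)
    ultimately show ?thesis by linarith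
  qed
  have "val P \<ge> min C C' * H P powr (-v)" if P: "P \<noteq> 0" "degree P \<le> Suc d" for P
  proof (cases "degree P = 0")
    case True
    have "min C C' * H P powr (-v) \<le> C * H P powr (-v)"
      by (intro mult_right_mono) auto
    also have "\<dots> \<le> val P" using True P by (intro C(2)) auto
    finally show ?thesis .
  next
    case False
    \<comment> \<open>Pass to the primitive part: neither the height nor the value increases.\<close>
    define R where "R = primitive_part P"
    define c where "c = content P"
    have PR: "P = smult c R" by (simp add: R_def c_def)
    have c: "c \<ge> 1" 
      using P content_ge_0_int[of P] content_eq_zero_iff[of P] unfolding c_def by linarith
    have R: "R \<noteq> 0" "degree R \<le> Suc d" "content R = 1" "degree R > 0"
      using P False by (auto simp: R_def)
    have "H R \<le> H P"
    proof -
      obtain i where "poly_height R = \<bar>coeff R i\<bar>"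
        using poly_height_attained by blast
      also have "\<dots> \<le> c * \<bar>coeff R i\<bar>"
        using c mult_right_mono[of 1 c "\<bar>coeff R i\<bar>"] by simp
      also have "\<dots> = \<bar>coeff P i\<bar>" using c by (simp add: PR abs_mult)
      also have "\<dots> \<le> poly_height P" by (rule abs_coeff_le_poly_height)
      finally show ?thesis by (simp add: H_def)
    qed
    then have "min C C' * H P powr (-v) \<le> C' * H R powr (-v)"
      using C' v H1[OF R(1)] by (intro mult_mono powr_mono2') auto
    also have "\<dots> \<le> val R" by (rule primitive_bound) fact+
    also have "\<dots> \<le> real_of_int c * val R"
      using c mult_right_mono[of 1 "real_of_int c" "val R"] by (simp add: val_def)
    also have "\<dots> = val P" using c by (simp add: PR val_def of_int_hom.map_poly_hom_smult abs_mult)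
    finally show ?thesis .
  qed
  then show ?case
    using C C' unfolding val_def H_def by (intro exI[of _ "min C C'"]) auto
qed

text \<open>The exponent \<open>w\<^sub>m\<close> is already approached by irreducible polynomials of arbitrarily
  large height. Otherwise all non-zero polynomials would satisfy \<open>\<bar>P(\<zeta>)\<bar> \<ge> C H(P) powr -v\<close>, and the gap
  between \<open>v\<close> and \<open>v'\<close> absorbs the constant.\<close>

lemma irreducible_approximants:
  fixes \<zeta> v v' B :: real
  assumes "\<not> algebraic \<zeta>" and "0 \<le> v" and "v < v'"
    and "\<exists>\<^sub>F X in at_top. small_poly_value m \<zeta> v' X"
  shows "\<exists>P. irreducible P \<and> degree P > 0 \<and> degree P \<le> m \<and> real_of_int (poly_height P) \<ge> B \<and>
             \<bar>poly (of_int_poly P) \<zeta>\<bar> \<le> real_of_int (poly_height P) powr (-v)"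
proof (rule ccontr)
  assume contra: "\<not> ?thesis"
  have "\<bar>poly (of_int_poly P) \<zeta>\<bar> > real_of_int (poly_height P) powr (-v)"
    if "irreducible P" "degree P > 0" "degree P \<le> m" "real_of_int (poly_height P) \<ge> B" for P
    using contra that not_le by blast
  from poly_lower_bound_of_irreducible[OF assms(1,2) this]
  obtain C where C: "C > 0"
    "\<And>P. P \<noteq> 0 \<Longrightarrow> degree P \<le> m \<Longrightarrow>
           \<bar>poly (of_int_poly P) \<zeta>\<bar> \<ge> C * real_of_int (poly_height P) powr (-v)"
    by blast
  have "\<forall>\<^sub>F X in at_top. X powr (-v') < C * X powr (-v)"
    using \<open>v < v'\<close> C(1) by real_asymp
  with assms(4) have "\<exists>\<^sub>F X in at_top. small_poly_value m \<zeta> v' X \<and> X powr (-v') < C * X powr (-v)"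
    by (rule frequently_eventually_frequently)
  then obtain X where X: "small_poly_value m \<zeta> v' X" "X powr (-v') < C * X powr (-v)"
    by (auto dest: frequently_ex)
  then obtain P where P: "degree P \<le> m" "real_of_int (poly_height P) \<le> X"
    "0 < \<bar>poly (of_int_poly P) \<zeta>\<bar>" "\<bar>poly (of_int_poly P) \<zeta>\<bar> \<le> X powr (-v')"
    unfolding small_poly_value_def by blast
  have "P \<noteq> 0" using P(3) by auto
  then have "C * X powr (-v) \<le> C * real_of_int (poly_height P) powr (-v)"
    using C(1) assms(2) P(2) poly_height_ge_1[of P] by (intro mult_left_mono powr_mono2') auto
  also have "\<dots> \<le> \<bar>poly (of_int_poly P) \<zeta>\<bar>"
    using C(2) \<open>P \<noteq> 0\<close> P(1) by blast
  finally show False using X(2) P(4) by linarith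
qed

section \<open>Small integers must vanish\<close>

text \<open>Replacing each \<open>z j\<close> by its approximation \<open>\<zeta>\<^sup>j x\<close> turns the pairing with
  \<open>R\<close> into \<open>x R(\<zeta>)\<close>; the second summand bounds the error.\<close>

lemma coeff_pairing_bound:
  fixes \<zeta> \<delta> h :: real and x :: int
  assumes z: "\<And>j. j \<le> k \<Longrightarrow> \<bar>real_of_int (z j) - \<zeta> ^ j * x\<bar> \<le> \<delta>"
    and h: "\<And>j. \<bar>real_of_int (coeff R j)\<bar> \<le> h" and "degree R \<le> k"
  shows "\<bar>real_of_int (coeff_pairing k z R)\<bar>
           \<le> \<bar>real_of_int x\<bar> * \<bar>poly (of_int_poly R) \<zeta>\<bar> + real (Suc k) * (h * \<delta>)"
proof -
  have "poly (of_int_poly R) \<zeta> = (\<Sum>j\<le>k. of_int (coeff R j) * \<zeta> ^ j)"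
  proof -
    have "poly (of_int_poly R) \<zeta> = (\<Sum>j\<le>degree R. of_int (coeff R j) * \<zeta> ^ j)"
      by (simp add: poly_altdef)
    also have "\<dots> = (\<Sum>j\<le>k. of_int (coeff R j) * \<zeta> ^ j)"
      using assms(3) by (intro sum.mono_neutral_left) (auto simp: coeff_eq_0)
    finally show ?thesis .
  qed
  then have "real_of_int (coeff_pairing k z R)
      = x * poly (of_int_poly R) \<zeta> + (\<Sum>j\<le>k. of_int (coeff R j) * (of_int (z j) - \<zeta> ^ j * x))"
    by (simp add: coeff_pairing_def sum_distrib_left right_diff_distrib sum_subtractf mult_ac)
  also have "\<bar>\<dots>\<bar> \<le> \<bar>x * poly (of_int_poly R) \<zeta>\<bar> + (\<Sum>j\<le>k. \<bar>of_int (coeff R j) * (of_int (z j) - \<zeta> ^ j * x)\<bar>)"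
    by (rule order_trans[OF abs_triangle_ineq add_left_mono[OF sum_abs]])
  also have "(\<Sum>j\<le>k. \<bar>of_int (coeff R j) * (of_int (z j) - \<zeta> ^ j * x)\<bar>) \<le> (\<Sum>j\<le>k. h * \<delta>)"
  proof (intro sum_mono)
    fix j assume "j \<in> {..k}"
    moreover have "0 \<le> h" using h[of 0] by linarith
    ultimately show "\<bar>of_int (coeff R j) * (of_int (z j) - \<zeta> ^ j * x)\<bar> \<le> h * \<delta>"
      unfolding abs_mult using z h by (intro mult_mono) auto
  qed
  finally show ?thesis by (simp add: abs_mult)
qed

text \<open>The pairing is an integer of absolute value less than 1. The factor
  \<open>(1 + \<bar>\<zeta>\<bar>)\<^sup>k\<close> bounds \<open>\<bar>\<zeta>\<bar>\<^sup>i\<close> uniformly in the shift.\<close>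

lemma coeff_pairing_shift_eq_0:
  fixes \<zeta> \<delta> h :: real and x :: int
  assumes z: "\<And>j. j \<le> k \<Longrightarrow> \<bar>real_of_int (z j) - \<zeta> ^ j * x\<bar> \<le> \<delta>"
    and P: "P \<noteq> 0" "real_of_int (poly_height P) \<le> h"
    and small: "\<bar>real_of_int x\<bar> * ((1 + \<bar>\<zeta>\<bar>) ^ k * \<bar>poly (of_int_poly P) \<zeta>\<bar>) + real (Suc k) * (h * \<delta>) < 1"
    and i: "i + degree P \<le> k"
  shows "coeff_pairing k z (monom 1 i * P) = 0"
proof -
  have "\<bar>real_of_int (coeff (monom 1 i * P) j)\<bar> \<le> h" for j
    using abs_coeff_le_poly_height[of P "j - i"] P(2) poly_height_ge_1[OF P(1)]
    by (auto simp: coeff_monom_mult)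
  moreover have "degree (monom 1 i * P) \<le> k"
    using degree_mult_le[of "monom 1 i" P] degree_monom_le[of "1::int" i] i by linarith
  ultimately have "\<bar>real_of_int (coeff_pairing k z (monom 1 i * P))\<bar>
      \<le> \<bar>real_of_int x\<bar> * \<bar>poly (of_int_poly (monom 1 i * P)) \<zeta>\<bar> + real (Suc k) * (h * \<delta>)"
    using z by (intro coeff_pairing_bound)
  also have "\<bar>poly (of_int_poly (monom 1 i * P)) \<zeta>\<bar> = \<bar>\<zeta>\<bar> ^ i * \<bar>poly (of_int_poly P) \<zeta>\<bar>"
    by (simp add: of_int_poly_hom.hom_mult poly_monom abs_mult power_abs)
  also have "\<bar>real_of_int x\<bar> * (\<bar>\<zeta>\<bar> ^ i * \<bar>poly (of_int_poly P) \<zeta>\<bar>)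
      \<le> \<bar>real_of_int x\<bar> * ((1 + \<bar>\<zeta>\<bar>) ^ k * \<bar>poly (of_int_poly P) \<zeta>\<bar>)"
  proof (intro mult_left_mono mult_right_mono)
    have "\<bar>\<zeta>\<bar> ^ i \<le> (1 + \<bar>\<zeta>\<bar>) ^ i" by (intro power_mono) auto
    also have "\<dots> \<le> (1 + \<bar>\<zeta>\<bar>) ^ k" using i by (intro power_increasing) auto
    finally show "\<bar>\<zeta>\<bar> ^ i \<le> (1 + \<bar>\<zeta>\<bar>) ^ k" .
  qed auto
  finally have "\<bar>real_of_int (coeff_pairing k z (monom 1 i * P))\<bar> < 1"
    using small by linarith
  then show ?thesis by linarith
qed

section \<open>Comparing the exponents\<close>

text \<open>The two terms are those of \<open>coeff_pairing_shift_eq_0\<close> for a polynomial of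
  height at most \<open>c H\<close> and value at most \<open>(c H) powr -v\<close>, with \<open>\<bar>x\<bar> \<le> H powr u\<close> and simultaneous approximation error
  \<open>H powr -s\<close>.\<close>

lemma eventually_error_terms_lt_1:
  fixes u v s Z N c :: real
  assumes "u < v" and "1 < s" and "Z > 0" and "N > 0" and "c > 0"
  shows "\<forall>\<^sub>F H in at_top. H powr u * (Z * (c * H) powr (-v)) + N * ((c * H) * H powr (-s)) < 1"
proof -
  have "((\<lambda>H. H powr u * (Z * (c * H) powr (-v))) \<longlongrightarrow> 0) at_top"
    using assms by real_asymp
  moreover have "((\<lambda>H. N * ((c * H) * H powr (-s))) \<longlongrightarrow> 0) at_top"
    using assms by real_asymp
  ultimately have "((\<lambda>H. H powr u * (Z * (c * H) powr (-v)) + N * ((c * H) * H powr (-s))) \<longlongrightarrow> 0) at_top"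
    by (rule tendsto_add_zero)
  then show ?thesis by (rule order_tendstoD) simp
qed

text \<open>The core of the argument. An irreducible \<open>P\<close> of large height \<open>H\<close> comes from
  the exponent \<open>w\<^sub>m\<close>. The uniform exponent then supplies a \<open>Q\<close> at the parameter \<open>c H\<close>, of height
  too small for a multiple of \<open>P\<close>. A simultaneous approximation at the parameter \<open>H powr u\<close>
  pairs to zero with all shifts of \<open>P\<close> and of \<open>Q\<close>, and must vanish.\<close>

lemma no_simul_approx_if_poly_approx:
  fixes \<zeta> \<eta> v v' :: real
  assumes "\<not> algebraic \<zeta>" and "m \<ge> 1" "n \<ge> 1" and v: "0 < v" "v < v'" "1 < v * \<eta>"
    and w: "\<exists>\<^sub>F X in at_top. small_poly_value m \<zeta> v' X"
    and what: "\<forall>\<^sub>F X in at_top. small_poly_value n \<zeta> v X"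
    and lam: "\<forall>\<^sub>F X in at_top. \<exists>(x :: int) (y :: nat \<Rightarrow> int).
          (x \<noteq> 0 \<or> (\<exists>i\<in>{1..m + n - 1}. y i \<noteq> 0)) \<and> \<bar>real_of_int x\<bar> \<le> X \<and>
          (MAX i\<in>{1..m + n - 1}. \<bar>\<zeta> ^ i * real_of_int x - real_of_int (y i)\<bar>) \<le> X powr (-\<eta>)"
  shows False
proof -
  define k where "k = m + n - 1"
  define Z where "Z = (1 + \<bar>\<zeta>\<bar>) ^ k"
  define K where "K = 4 ^ n * real (Suc n)"
  \<comment> \<open>A non-zero multiple of \<open>P\<close> of degree at most \<open>n\<close> has height at least \<open>H(P) / K\<close>, so height at most \<open>c H(P)\<close> is too small.\<close>
  define c where "c = 1 / (2 * K)"
  have K: "K > 0" by (simp add: K_def)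
  have c: "c > 0" "K * c < 1" using K by (auto simp: c_def)
  have "\<eta> > 0" using v by (smt (verit) mult_nonneg_nonpos)
  \<comment> \<open>Below \<open>v\<close>, so that \<open>H powr u\<close> times the polynomial values is small; above \<open>1 / \<eta>\<close>,
    so that the approximation error times \<open>H\<close> is small.\<close>
  then obtain u where u: "1 / \<eta> < u" "u < v"
    using v by (metis dense divide_less_eq)
  then have u0: "u > 0" "u * \<eta> > 1"
    using \<open>\<eta> > 0\<close> less_trans[of 0 "1 / \<eta>" u] by (simp_all add: pos_divide_less_eq)
  have Hu: "filterlim (\<lambda>H. H powr u) at_top at_top"
    using u0 by real_asymp
  have cH: "filterlim (\<lambda>H. c * H) at_top at_top"
    using c by real_asymp
  have ZN: "Z > 0" "real (Suc k) > 0" by (auto simp: Z_def intro!: zero_less_power add_pos_nonneg)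
  have small1: "\<forall>\<^sub>F H in at_top. H powr u * (Z * H powr (-v)) + real (Suc k) * (H * H powr (- (u * \<eta>))) < 1"
    using eventually_error_terms_lt_1[OF u(2) u0(2) ZN, of 1] by simp
  have small2: "\<forall>\<^sub>F H in at_top. H powr u * (Z * (c * H) powr (-v)) + real (Suc k) * ((c * H) * H powr (- (u * \<eta>))) < 1"
    by (rule eventually_error_terms_lt_1[OF u(2) u0(2) ZN c(1)])
  have "\<forall>\<^sub>F H in at_top. H > 0 \<and> small_poly_value n \<zeta> v (c * H) \<and>
      (\<exists>(x :: int) (y :: nat \<Rightarrow> int).
          (x \<noteq> 0 \<or> (\<exists>i\<in>{1..k}. y i \<noteq> 0)) \<and> \<bar>real_of_int x\<bar> \<le> H powr u \<and>
          (MAX i\<in>{1..k}. \<bar>\<zeta> ^ i * real_of_int x - real_of_int (y i)\<bar>) \<le> (H powr u) powr (-\<eta>)) \<and>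
      H powr u * (Z * H powr (-v)) + real (Suc k) * (H * H powr (- (u * \<eta>))) < 1 \<and>
      H powr u * (Z * (c * H) powr (-v)) + real (Suc k) * ((c * H) * H powr (- (u * \<eta>))) < 1"
    using eventually_compose_filterlim[OF lam Hu] eventually_compose_filterlim[OF what cH] small1 small2
      eventually_gt_at_top[of 0] unfolding k_def
    by eventually_elim blast
  then obtain B where B: "\<And>H. H \<ge> B \<Longrightarrow> H > 0 \<and> small_poly_value n \<zeta> v (c * H) \<and>
      (\<exists>(x :: int) (y :: nat \<Rightarrow> int).
          (x \<noteq> 0 \<or> (\<exists>i\<in>{1..k}. y i \<noteq> 0)) \<and> \<bar>real_of_int x\<bar> \<le> H powr u \<and>
          (MAX i\<in>{1..k}. \<bar>\<zeta> ^ i * real_of_int x - real_of_int (y i)\<bar>) \<le> (H powr u) powr (-\<eta>)) \<and>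
      H powr u * (Z * H powr (-v)) + real (Suc k) * (H * H powr (- (u * \<eta>))) < 1 \<and>
      H powr u * (Z * (c * H) powr (-v)) + real (Suc k) * ((c * H) * H powr (- (u * \<eta>))) < 1"
    unfolding eventually_at_top_linorder by blast
  \<comment> \<open>Only now is \<open>H\<close> fixed: it has to be the height of a polynomial provided by the exponent \<open>w\<^sub>m\<close>.\<close>
  obtain P where P: "irreducible P" "degree P > 0" "degree P \<le> m" "real_of_int (poly_height P) \<ge> B"
    "\<bar>poly (of_int_poly P) \<zeta>\<bar> \<le> real_of_int (poly_height P) powr (-v)"
    using irreducible_approximants[OF assms(1) _ v(2) w, of B] v(1) by auto
  define H where "H = real_of_int (poly_height P)"
  note BH = B[OF P(4), folded H_def]
  have H0: "H > 0" using BH by blast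
  obtain Q where Q: "degree Q \<le> n" "real_of_int (poly_height Q) \<le> c * H"
    "0 < \<bar>poly (of_int_poly Q) \<zeta>\<bar>" "\<bar>poly (of_int_poly Q) \<zeta>\<bar> \<le> (c * H) powr (-v)"
    using BH unfolding small_poly_value_def by blast
  have nz: "P \<noteq> 0" "Q \<noteq> 0" using P(2) Q(3) by auto
  have ndvd: "\<not> P dvd Q"
  proof
    assume "P dvd Q"
    then have "H \<le> K * real_of_int (poly_height Q)"
      using poly_height_le_if_dvd nz Q(1) unfolding H_def K_def by blast
    also have "\<dots> \<le> K * (c * H)" using Q(2) K by (intro mult_left_mono) auto
    also have "\<dots> < 1 * H" unfolding mult.assoc[symmetric] using c H0 by (intro mult_strict_right_mono)
    finally show False by simp
  qed
  define \<delta> where "\<delta> = H powr (- (u * \<eta>))"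
  obtain x :: int and y :: "nat \<Rightarrow> int" where xy: "x \<noteq> 0 \<or> (\<exists>i\<in>{1..k}. y i \<noteq> 0)"
    "\<bar>real_of_int x\<bar> \<le> H powr u"
    "(MAX i\<in>{1..k}. \<bar>\<zeta> ^ i * real_of_int x - real_of_int (y i)\<bar>) \<le> \<delta>"
    using BH unfolding \<delta>_def by (auto simp: powr_powr)
  \<comment> \<open>The vector \<open>(x, y\<^sub>1, \<dots>, y\<^sub>k)\<close>, with \<open>x\<close> as the entry belonging to \<open>\<zeta>\<^sup>0\<close>.\<close>
  define z where "z = y(0 := x)"
  have z: "\<bar>real_of_int (z j) - \<zeta> ^ j * x\<bar> \<le> \<delta>" if "j \<le> k" for j
  proof (cases "j = 0")
    case True
    then show ?thesis by (simp add: z_def \<delta>_def)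
  next
    case False
    with that have "\<bar>\<zeta> ^ j * real_of_int x - real_of_int (y j)\<bar>
        \<le> (MAX i\<in>{1..k}. \<bar>\<zeta> ^ i * real_of_int x - real_of_int (y i)\<bar>)"
      by (intro Max_ge) auto
    with xy(3) False show ?thesis by (simp add: z_def abs_minus_commute)
  qed
  have small: "\<bar>real_of_int x\<bar> * (Z * \<bar>poly (of_int_poly R) \<zeta>\<bar>) + real (Suc k) * (h * \<delta>) < 1"
    if "H powr u * (Z * e) + real (Suc k) * (h * \<delta>) < 1" "\<bar>poly (of_int_poly R) \<zeta>\<bar> \<le> e" for R h e
  proof -
    have "\<bar>real_of_int x\<bar> * (Z * \<bar>poly (of_int_poly R) \<zeta>\<bar>) \<le> H powr u * (Z * e)"
      using xy(2) that(2) by (intro mult_mono) (auto simp: Z_def)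
    with that(1) show ?thesis by linarith
  qed
  have zero: "z j = 0" if "j \<le> k" for j
  proof (rule irreducible_not_dvd_annihilate[OF P(1,2) ndvd _ _ _ that])
    show "degree P + degree Q \<le> Suc k" using P(3) Q(1) assms(2,3) by (simp add: k_def)
    have smallP: "\<bar>real_of_int x\<bar> * (Z * \<bar>poly (of_int_poly P) \<zeta>\<bar>) + real (Suc k) * (H * \<delta>) < 1"
      by (rule small[of "H powr (-v)"]) (use BH P(5) in \<open>auto simp: H_def \<delta>_def\<close>)
    show "coeff_pairing k z (monom 1 i * P) = 0" if "i + degree P \<le> k" for i
      using coeff_pairing_shift_eq_0[OF z nz(1) _ smallP[unfolded Z_def] that] by (simp add: H_def)
    have smallQ: "\<bar>real_of_int x\<bar> * (Z * \<bar>poly (of_int_poly Q) \<zeta>\<bar>) + real (Suc k) * (c * H * \<delta>) < 1"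
      by (rule small[of "(c * H) powr (-v)"]) (use BH Q in \<open>auto simp: \<delta>_def\<close>)
    show "coeff_pairing k z (monom 1 i * Q) = 0" if "i + degree Q \<le> k" for i
      using coeff_pairing_shift_eq_0[OF z nz(2) Q(2) smallQ[unfolded Z_def] that] .
  qed
  from zero[of 0] have "x = 0" by (simp add: z_def)
  moreover have "y i = 0" if "i \<in> {1..k}" for i
    using zero[of i] that by (simp add: z_def)
  ultimately show False using xy(1) by blast
qed

lemma small_poly_value_mono:
  assumes "small_poly_value k \<zeta> v' X" and "v \<le> v'" and "X \<ge> 1"
  shows "small_poly_value k \<zeta> v X"
proof -
  have "X powr (-v') \<le> X powr (-v)" using assms by (intro powr_mono) auto
  then show ?thesis using assms(1) unfolding small_poly_value_def by (meson order_trans)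
qed

text \<open>The constant polynomial 1 shows that both polynomial exponents are
  non-negative.\<close>

lemma small_poly_value_0: "X \<ge> 1 \<Longrightarrow> small_poly_value k \<zeta> 0 X"
  unfolding small_poly_value_def by (intro exI[of _ 1]) (auto simp: poly_height_def)

text \<open>For \<open>w = 0\<close> the hypothesis fails since \<open>1 / 0 = \<infinity>\<close> in the extended
  reals, and for \<open>w = \<infinity>\<close> it says that \<open>\<eta>\<close> is positive.\<close>

lemma ereal_inverse_lt_imp:
  assumes "0 \<le> w" and "1 / w < ereal \<eta>"
  shows "\<exists>v>0. ereal v < w \<and> 1 < v * \<eta>"
proof (cases w)
  case (real r)
  with assms have r: "r > 0" by (cases "r = 0") (auto simp: one_ereal_def)
  with assms real have "1 / r < \<eta>" by (simp add: one_ereal_def)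
  moreover have "0 < 1 / r" using r by simp
  ultimately have "\<eta> > 0" by linarith
  with r \<open>1 / r < \<eta>\<close> have "1 / \<eta> < r" by (simp add: field_simps)
  then obtain v where v: "1 / \<eta> < v" "v < r" using dense by blast
  moreover have "0 < 1 / \<eta>" using \<open>\<eta> > 0\<close> by simp
  ultimately have "v > 0" by linarith
  with v real \<open>\<eta> > 0\<close> show ?thesis
    by (intro exI[of _ v]) (simp add: pos_divide_less_eq)
next
  case PInf
  with assms have "\<eta> > 0" by simp
  then show ?thesis using PInf by (intro exI[of _ "2 / \<eta>"]) auto
qed (use assms in auto)

theorem theorem2p1:
  fixes m n :: nat and \<zeta> :: real
  assumes "m \<ge> 1" and "n \<ge> 1" and "\<not> algebraic \<zeta>"
  shows "simul_approx_exp_unif (m + n - 1) \<zeta>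
           \<le> max (1 / poly_approx_exp m \<zeta>) (1 / poly_approx_exp_unif n \<zeta>)"
  unfolding simul_approx_exp_unif_def
proof (rule SUP_least, clarify, rule ccontr)
  fix \<eta> :: real
  let ?w = "poly_approx_exp m \<zeta>" and ?w' = "poly_approx_exp_unif n \<zeta>"
  assume lam: "\<forall>\<^sub>F X in at_top. \<exists>(x :: int) (y :: nat \<Rightarrow> int).
          (x \<noteq> 0 \<or> (\<exists>i\<in>{1..m + n - 1}. y i \<noteq> 0)) \<and> \<bar>real_of_int x\<bar> \<le> X \<and>
          (MAX i\<in>{1..m + n - 1}. \<bar>\<zeta> ^ i * real_of_int x - real_of_int (y i)\<bar>) \<le> X powr (-\<eta>)"
  assume "\<not> ereal \<eta> \<le> max (1 / ?w) (1 / ?w')"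
  then have lt: "1 / ?w < ereal \<eta>" "1 / ?w' < ereal \<eta>" by (simp_all add: not_le)
  have ev0: "\<forall>\<^sub>F X in at_top. small_poly_value k \<zeta> 0 X" for k
    using eventually_ge_at_top[of 1] by eventually_elim (rule small_poly_value_0)
  have "0 \<le> ?w" unfolding poly_approx_exp_def zero_ereal_def
    by (rule SUP_upper) (use eventually_frequently[OF _ ev0] in simp)
  then obtain v1 where v1: "v1 > 0" "ereal v1 < ?w" "1 < v1 * \<eta>"
    using ereal_inverse_lt_imp lt by blast
  have "0 \<le> ?w'" unfolding poly_approx_exp_unif_def zero_ereal_def
    by (rule SUP_upper) (use ev0 in simp)
  then obtain v2 where v2: "v2 > 0" "ereal v2 < ?w'" "1 < v2 * \<eta>"
    using ereal_inverse_lt_imp lt by blast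
  define v where "v = min v1 v2"
  have v: "v > 0" "1 < v * \<eta>" "ereal v < ?w" "ereal v < ?w'"
    using v1 v2 le_less_trans[of "ereal v" "ereal v1"] le_less_trans[of "ereal v" "ereal v2"]
    by (auto simp: v_def min_def)
  obtain v' where v': "v < v'" "\<exists>\<^sub>F X in at_top. small_poly_value m \<zeta> v' X"
    using v(3) unfolding poly_approx_exp_def less_SUP_iff by auto
  obtain v'' where v'': "v < v''" "\<forall>\<^sub>F X in at_top. small_poly_value n \<zeta> v'' X"
    using v(4) unfolding poly_approx_exp_unif_def less_SUP_iff by auto
  from v''(2) eventually_ge_at_top[of 1]
  have "\<forall>\<^sub>F X in at_top. small_poly_value n \<zeta> v X"
    by eventually_elim (use v''(1) in \<open>auto intro: small_poly_value_mono\<close>)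
  from no_simul_approx_if_poly_approx[OF assms(3,1,2) v(1) v'(1) v(2) v'(2) this lam]
  show False .
qed

end
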